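(* Let $N=\{1,\ldots,n\}$ and let a bisubmodular function $h:3^N\to\mathbb{R}$ and vectors $a \in \mathbb{R}^n_{>0}$ and $b \in \mathbb{R}^n$ be given. Then the following hold: (i) any solution to the problem $\min_{x \in \tilde{B}(h)} \sum_{i\in N} \frac{1}{2} \frac{(x_i + b_i)^2}{a_i}$ is a least weakly absolutely $(a,b)$-majorized element of $\tilde{B}(h)$; (ii) if $h$ and $b$ are integral, then any solution to the problem $\min_{x \in \tilde{B}^{\mathbb{Z}}(h)} \sum_{i\in N} \frac{1}{2} (x_i + b_i)^2$ is a least weakly absolutely $(1,b)$-majorized element of $\tilde{B}^{\mathbb{Z}}(h)$.
   Context: Notation: $x(A) := \sum_{i\in A} x_i$ for $x\in\mathbb{R}^n$, $A\subseteq N$; in "$(1,b)$", $1$ is the all-ones vector; "integral" means integer-valued; "solution" of a minimization problem means optimal solution. $3^N$ is the set of ordered pairs $(S,T)$ of disjoint subsets of $N$. $h:3^N\to\mathbb{R}$ with $h(\emptyset,\emptyset)=0$ is bisubmodular if for all $(S_1,T_1),(S_2,T_2)\in 3^N$, $h(S_1,T_1)+h(S_2,T_2)\ge h\big((S_1\cup S_2)\setminus(T_1\cup T_2),(T_1\cup T_2)\setminus(S_1\cup S_2)\big)+h(S_1\cap S_2,T_1\cap T_2)$. $\tilde B(h):=\{x\in\mathbb{R}^n: x(S)-x(T)\le h(S,T)\ \forall (S,T)\in 3^N\}$ and $\tilde B^{\mathbb{Z}}(h):=\tilde B(h)\cap\mathbb{Z}^n$. For $a\in\mathbb{R}^n_{>0}$,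 $b\in\mathbb{R}^n$, $x$ is weakly absolutely $(a,b)$-majorized by $y$ if $\sum_{i\in N} a_i\phi\left(\frac{x_i+b_i}{a_i}\right)\le \sum_{i\in N} a_i\phi\left(\frac{y_i+b_i}{a_i}\right)$ for all even continuous convex functions $\phi:\mathbb{R}\to\mathbb{R}$. For $C\subseteq\mathbb{R}^n$, $x\in C$ is a least weakly absolutely $(a,b)$-majorized element of $C$ if $x$ is weakly absolutely $(a,b)$-majorized by every $y\in C$. *)

theory Defs
  imports "HOL-Analysis.Analysis"
begin

text \<open>The ground set \<open>N = {1, ..., n}\<close> is rendered by a finite index type \<open>'n\<close> with
  \<open>n = CARD('n)\<close>, and \<open>\<real>^n\<close> by \<open>real ^ 'n\<close>.\<close>

definition vsum :: "real ^ 'n \<Rightarrow> 'n set \<Rightarrow> real" where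
  "vsum x A = (\<Sum>i\<in>A. x $ i)"

definition disjoint_pairs :: "('n set \<times> 'n set) set" where
  "disjoint_pairs = {(S, T). S \<inter> T = {}}"

text \<open>A function on \<open>disjoint_pairs\<close> is represented by a total function on all pairs of sets;
  every notion below only inspects its values on \<open>disjoint_pairs\<close>. (Both pairs occurring
  on the right of the inequality are again disjoint.)\<close>

definition bisubmodular :: "('n set \<times> 'n set \<Rightarrow> real) \<Rightarrow> bool" where
  "bisubmodular h \<longleftrightarrow>
     h ({}, {}) = 0 \<and>
     (\<forall>(S1, T1) \<in> disjoint_pairs. \<forall>(S2, T2) \<in> disjoint_pairs.
        h (S1, T1) + h (S2, T2) \<ge>
          h ((S1 \<union> S2) - (T1 \<union> T2), (T1 \<union> T2) - (S1 \<union> S2)) + h (S1 \<inter> S2, T1 \<inter> T2))"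

definition bisub_polyhedron :: "('n::finite set \<times> 'n set \<Rightarrow> real) \<Rightarrow> (real ^ 'n) set" where
  "bisub_polyhedron h = {x. \<forall>(S, T) \<in> disjoint_pairs. vsum x S - vsum x T \<le> h (S, T)}"

definition integral_vec :: "real ^ 'n \<Rightarrow> bool" where
  "integral_vec x \<longleftrightarrow> (\<forall>i. x $ i \<in> \<int>)"

definition integral_setfun :: "('n set \<times> 'n set \<Rightarrow> real) \<Rightarrow> bool" where
  "integral_setfun h \<longleftrightarrow> (\<forall>(S, T) \<in> disjoint_pairs. h (S, T) \<in> \<int>)"

definition bisub_polyhedron_int :: "('n::finite set \<times> 'n set \<Rightarrow> real) \<Rightarrow> (real ^ 'n) set" where
  "bisub_polyhedron_int h = bisub_polyhedron h \<inter> {x. integral_vec x}"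

text \<open>Meaningful only for \<open>a\<close> with positive components.\<close>

definition weakly_abs_majorized ::
  "real ^ 'n::finite \<Rightarrow> real ^ 'n \<Rightarrow> real ^ 'n \<Rightarrow> real ^ 'n \<Rightarrow> bool" where
  "weakly_abs_majorized a b x y \<longleftrightarrow>
     (\<forall>\<phi> :: real \<Rightarrow> real.
        (\<forall>t. \<phi> (- t) = \<phi> t) \<and> continuous_on UNIV \<phi> \<and> convex_on UNIV \<phi> \<longrightarrow>
        (\<Sum>i\<in>UNIV. a $ i * \<phi> ((x $ i + b $ i) / a $ i))
          \<le> (\<Sum>i\<in>UNIV. a $ i * \<phi> ((y $ i + b $ i) / a $ i)))"

definition least_weakly_abs_majorized ::
  "real ^ 'n::finite \<Rightarrow> real ^ 'n \<Rightarrow> (real ^ 'n) set \<Rightarrow> real ^ 'n \<Rightarrow> bool" where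
  "least_weakly_abs_majorized a b C x \<longleftrightarrow> x \<in> C \<and> (\<forall>y\<in>C. weakly_abs_majorized a b x y)"

end

theory Submission imports Defs begin

text \<open>
  Put \<open>z i = (x i + b i) / a i\<close>. On the finitely many values involved, an even convex function is
  a nonnegative combination of a constant and hinges \<open>max 0 (\<bar>t\<bar> - c)\<close> with kinks \<open>c \<ge> 0\<close> among
  these values, so only hinges have to be compared; in the integral case every \<open>c\<close> is an integer.
  For a hinge it suffices to find a pair \<open>(S, T)\<close> whose constraint is tight at \<open>x\<close>, with
  \<open>{z < -c} \<subseteq> S \<subseteq> {z \<le> -c}\<close> and \<open>{z > c} \<subseteq> T \<subseteq> {z \<ge> c}\<close>: tightness is the dual certificate.
  If \<open>z i < -c\<close>, optimality blocks increasing \<open>x i\<close>, so some tight pair has \<open>i \<in> S\<close>. Tight pairs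
  are closed under the two bisubmodular operations, and for the least tight pair with \<open>i \<in> S\<close> the
  exchanges of \<open>i\<close> with any other member are feasible; as they do not lower the quadratic
  cost, the pair lies inside the level sets. Joining these pairs over all \<open>i\<close> gives the certificate.
\<close>

section \<open>Tight pairs\<close>

definition slack :: "('n::finite set \<times> 'n set \<Rightarrow> real) \<Rightarrow> real ^ 'n \<Rightarrow> 'n set \<Rightarrow> 'n set \<Rightarrow> real" where
  "slack h x S T = h (S, T) - (vsum x S - vsum x T)"

definition tight :: "('n::finite set \<times> 'n set \<Rightarrow> real) \<Rightarrow> real ^ 'n \<Rightarrow> 'n set \<Rightarrow> 'n set \<Rightarrow> bool" where
  "tight h x S T \<longleftrightarrow> S \<inter> T = {} \<and> slack h x S T = 0"

lemma bisub_polyhedron_iff_slack: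
  "x \<in> bisub_polyhedron h \<longleftrightarrow> (\<forall>S T. S \<inter> T = {} \<longrightarrow> slack h x S T \<ge> 0)"
  by (auto simp: bisub_polyhedron_def disjoint_pairs_def slack_def)

lemma vsum_diff_eq_sum:
  fixes x :: "real ^ 'n::finite"
  shows "vsum x S - vsum x T = (\<Sum>i\<in>UNIV. x $ i * (of_bool (i \<in> S) - of_bool (i \<in> T)))"
  by (simp add: vsum_def right_diff_distrib sum_subtractf sum_mult_of_bool_eq)

text \<open>Coordinatewise, a disjoint pair is a sign vector with entries 1, 0, -1. The signs of two
  pairs add up to the sign in the reduced union plus the sign in the intersection; opposite signs
  cancel to 0 on both sides.\<close>

lemma vsum_diff_modular:
  fixes x :: "real ^ 'n::finite"
  assumes "S1 \<inter> T1 = {}" "S2 \<inter> T2 = {}"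
  shows "(vsum x S1 - vsum x T1) + (vsum x S2 - vsum x T2) =
    (vsum x ((S1 \<union> S2) - (T1 \<union> T2)) - vsum x ((T1 \<union> T2) - (S1 \<union> S2)))
    + (vsum x (S1 \<inter> S2) - vsum x (T1 \<inter> T2))"
  unfolding vsum_diff_eq_sum sum.distrib [symmetric] distrib_left [symmetric]
  by (rule sum.cong) (use assms in \<open>auto simp: of_bool_def\<close>)

text \<open>Subtracting a modular function keeps the bisubmodular inequality.\<close>

lemma slack_bisubmodular:
  assumes "bisubmodular h" "S1 \<inter> T1 = {}" "S2 \<inter> T2 = {}"
  shows "slack h x ((S1 \<union> S2) - (T1 \<union> T2)) ((T1 \<union> T2) - (S1 \<union> S2))
      + slack h x (S1 \<inter> S2) (T1 \<inter> T2) \<le> slack h x S1 T1 + slack h x S2 T2"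
proof -
  have "h ((S1 \<union> S2) - (T1 \<union> T2), (T1 \<union> T2) - (S1 \<union> S2)) + h (S1 \<inter> S2, T1 \<inter> T2)
      \<le> h (S1, T1) + h (S2, T2)"
    using assms unfolding bisubmodular_def disjoint_pairs_def by auto
  with vsum_diff_modular [OF assms(2,3), of x] show ?thesis
    unfolding slack_def by linarith
qed

lemma slack_diff_scaleR:
  "slack h (x + \<epsilon> *\<^sub>R d) S T = slack h x S T - \<epsilon> * (vsum d S - vsum d T)"
  by (simp add: slack_def vsum_def sum.distrib sum_distrib_left algebra_simps)

text \<open>At a feasible point the two resulting slacks are nonnegative, and their sum is at most 0
  + 0.\<close>

lemma tight_union_inter:
  assumes h: "bisubmodular h" and x: "x \<in> bisub_polyhedron h"
    and t: "tight h x S1 T1" "tight h x S2 T2"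
  shows "tight h x ((S1 \<union> S2) - (T1 \<union> T2)) ((T1 \<union> T2) - (S1 \<union> S2))"
    and "tight h x (S1 \<inter> S2) (T1 \<inter> T2)"
proof -
  have d: "S1 \<inter> T1 = {}" "S2 \<inter> T2 = {}" and z: "slack h x S1 T1 = 0" "slack h x S2 T2 = 0"
    using t by (auto simp: tight_def)
  have d': "((S1 \<union> S2) - (T1 \<union> T2)) \<inter> ((T1 \<union> T2) - (S1 \<union> S2)) = {}"
    "(S1 \<inter> S2) \<inter> (T1 \<inter> T2) = {}"
    using d by auto
  have "slack h x ((S1 \<union> S2) - (T1 \<union> T2)) ((T1 \<union> T2) - (S1 \<union> S2)) \<ge> 0"
    "slack h x (S1 \<inter> S2) (T1 \<inter> T2) \<ge> 0"
    using x d' unfolding bisub_polyhedron_iff_slack by blast+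
  with slack_bisubmodular [OF h d, of x] z d'
  show "tight h x ((S1 \<union> S2) - (T1 \<union> T2)) ((T1 \<union> T2) - (S1 \<union> S2))"
    and "tight h x (S1 \<inter> S2) (T1 \<inter> T2)"
    unfolding tight_def by auto
qed

lemma tight_empty: "bisubmodular h \<Longrightarrow> tight h x {} {}"
  by (simp add: tight_def slack_def vsum_def bisubmodular_def)

section \<open>Feasible exchange steps\<close>

lemma vsum_axis: "vsum (axis i 1) S = of_bool (i \<in> S)" for i :: "'n::finite"
  by (simp add: vsum_def axis_def)

lemma vsum_add: "vsum (x + y) S = vsum x S + vsum y S"
  and vsum_minus: "vsum (x - y) S = vsum x S - vsum y S"
  by (simp_all add: vsum_def sum.distrib sum_subtractf)

text \<open>The common abstraction of the real case (small \<open>\<epsilon>\<close>) and the integral case (\<open>\<epsilon> = 1\<close>).\<close>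

definition granular :: "('n::finite set \<times> 'n set \<Rightarrow> real) \<Rightarrow> real ^ 'n \<Rightarrow> real \<Rightarrow> bool" where
  "granular h x \<epsilon> \<longleftrightarrow> \<epsilon> > 0 \<and> (\<forall>S T. S \<inter> T = {} \<longrightarrow> slack h x S T = 0 \<or> slack h x S T \<ge> \<epsilon>)"

lemma infeasible_stepE:
  assumes "x + \<epsilon> *\<^sub>R d \<notin> bisub_polyhedron h"
  obtains S T where "S \<inter> T = {}" "slack h x S T < \<epsilon> * (vsum d S - vsum d T)"
proof -
  obtain S T where "S \<inter> T = {}" "\<not> slack h (x + \<epsilon> *\<^sub>R d) S T \<ge> 0"
    using assms unfolding bisub_polyhedron_iff_slack by blast
  then show ?thesis using that [of S T] by (simp add: slack_diff_scaleR)
qed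

text \<open>Raising \<open>x $ i\<close> by \<open>\<epsilon>\<close> uses up slack only where
  \<open>i \<in> S\<close>, and at most \<open>\<epsilon>\<close> of it. A violated constraint thus
  has slack below \<open>\<epsilon>\<close>, which granularity forces to 0.\<close>

lemma infeasible_axis_imp_tight:
  assumes g: "granular h x \<epsilon>" and x: "x \<in> bisub_polyhedron h"
    and inf: "x + \<epsilon> *\<^sub>R axis i 1 \<notin> bisub_polyhedron h"
  obtains S T where "tight h x S T" "i \<in> S"
proof -
  obtain S T where d: "S \<inter> T = {}"
    and lt: "slack h x S T < \<epsilon> * (vsum (axis i 1) S - vsum (axis i 1) T)"
    using infeasible_stepE [OF inf] by blast
  have pos: "\<epsilon> > 0" and gr: "slack h x S T = 0 \<or> slack h x S T \<ge> \<epsilon>"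
    and nn: "slack h x S T \<ge> 0"
    using g d x unfolding granular_def bisub_polyhedron_iff_slack by auto
  have "i \<in> S" "slack h x S T = 0"
    using lt pos gr nn by (auto simp: vsum_axis of_bool_def split: if_splits)
  with d show ?thesis using that unfolding tight_def by blast
qed

text \<open>A step of the form \<open>axis i 1 \<plusminus> axis j 1\<close> can violate a constraint whose slack is positive but
  below \<open>2 * \<epsilon>\<close>. Combined with a tight pair, that constraint still yields a tight pair, since the
  slacks of the union and of the intersection cannot both reach \<open>\<epsilon>\<close>.\<close>

lemma infeasible_combination:
  assumes h: "bisubmodular h" and g: "granular h x \<epsilon>" and x: "x \<in> bisub_polyhedron h"
    and t: "tight h x S T"
    and d: "S' \<inter> T' = {}" and lt: "slack h x S' T' < 2 * \<epsilon>"
  shows "tight h x ((S \<union> S') - (T \<union> T')) ((T \<union> T') - (S \<union> S')) \<or> tight h x (S \<inter> S') (T \<inter> T')"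
proof -
  have d0: "S \<inter> T = {}" and z: "slack h x S T = 0" using t by (auto simp: tight_def)
  have d': "((S \<union> S') - (T \<union> T')) \<inter> ((T \<union> T') - (S \<union> S')) = {}"
    "(S \<inter> S') \<inter> (T \<inter> T') = {}"
    using d by auto
  have "slack h x ((S \<union> S') - (T \<union> T')) ((T \<union> T') - (S \<union> S')) = 0
      \<or> slack h x ((S \<union> S') - (T \<union> T')) ((T \<union> T') - (S \<union> S')) \<ge> \<epsilon>"
    "slack h x (S \<inter> S') (T \<inter> T') = 0 \<or> slack h x (S \<inter> S') (T \<inter> T') \<ge> \<epsilon>"
    using g d' unfolding granular_def by blast+
  with slack_bisubmodular [OF h d0 d, of x] z lt d' show ?thesis
    unfolding tight_def by linarith
qed

text \<open>The violated constraint need not itself be tight or have \<open>i\<close> in its first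
  component. Combining it with the given tight pair repairs both defects.\<close>

lemma infeasible_axis_diff_imp_tight:
  assumes h: "bisubmodular h" and g: "granular h x \<epsilon>" and x: "x \<in> bisub_polyhedron h"
    and t: "tight h x S T" and i: "i \<in> S" and j: "j \<noteq> i"
    and inf: "x + \<epsilon> *\<^sub>R (axis i 1 - axis j 1) \<notin> bisub_polyhedron h"
  obtains S' T' where "tight h x S' T'" "i \<in> S'" "j \<notin> S'"
proof -
  obtain S' T' where d: "S' \<inter> T' = {}"
    and lt: "slack h x S' T'
      < \<epsilon> * (vsum (axis i 1 - axis j 1) S' - vsum (axis i 1 - axis j 1) T')"
    using infeasible_stepE [OF inf] by blast
  have pos: "\<epsilon> > 0" and gr: "slack h x S' T' = 0 \<or> slack h x S' T' \<ge> \<epsilon>"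
    and nn: "slack h x S' T' \<ge> 0"
    using g d x unfolding granular_def bisub_polyhedron_iff_slack by auto
  have iT: "i \<notin> T" using t i by (auto simp: tight_def)
  \<comment> \<open>The step uses up \<open>2 * \<epsilon>\<close> only if \<open>i \<in> S'\<close>
    and \<open>j \<in> T'\<close>. Otherwise it uses up at most \<open>\<epsilon>\<close>, and
    granularity makes the violated constraint tight.\<close>
  consider "i \<in> S'" "j \<in> T'" "slack h x S' T' < 2 * \<epsilon>"
    | "i \<in> S'" "j \<notin> S'" "slack h x S' T' = 0"
    | "i \<notin> T'" "j \<in> T'" "slack h x S' T' = 0"
    using lt pos gr nn d by (auto simp: vsum_axis vsum_minus of_bool_def split: if_splits)
  then show ?thesis
  proof cases
    \<comment> \<open>Whichever of union and intersection is tight, its first component contains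
      \<open>i\<close>. It omits \<open>j\<close> because \<open>j \<in> T'\<close>.\<close>
    case 1
    then show ?thesis
      using infeasible_combination [OF h g x t d] that i iT d by auto
  next
    case 2
    then have "tight h x S' T'" using d by (simp add: tight_def)
    with 2 show ?thesis using that by blast
  next
    case 3
    then have "tight h x S' T'" using d by (simp add: tight_def)
    with 3 show ?thesis using tight_union_inter(1) [OF h x t] that i iT by auto
  qed
qed

text \<open>The same case analysis with the sign of \<open>j\<close> reversed: membership of
  \<open>j\<close> in the first component now keeps it out of the second.\<close>

lemma infeasible_axis_add_imp_tight:
  assumes h: "bisubmodular h" and g: "granular h x \<epsilon>" and x: "x \<in> bisub_polyhedron h"
    and t: "tight h x S T" and i: "i \<in> S" and j: "j \<noteq> i"
    and inf: "x + \<epsilon> *\<^sub>R (axis i 1 + axis j 1) \<notin> bisub_polyhedron h"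
  obtains S' T' where "tight h x S' T'" "i \<in> S'" "j \<notin> T'"
proof -
  obtain S' T' where d: "S' \<inter> T' = {}"
    and lt: "slack h x S' T'
      < \<epsilon> * (vsum (axis i 1 + axis j 1) S' - vsum (axis i 1 + axis j 1) T')"
    using infeasible_stepE [OF inf] by blast
  have pos: "\<epsilon> > 0" and gr: "slack h x S' T' = 0 \<or> slack h x S' T' \<ge> \<epsilon>"
    and nn: "slack h x S' T' \<ge> 0"
    using g d x unfolding granular_def bisub_polyhedron_iff_slack by auto
  have iT: "i \<notin> T" using t i by (auto simp: tight_def)
  consider "i \<in> S'" "j \<in> S'" "slack h x S' T' < 2 * \<epsilon>"
    | "i \<in> S'" "j \<notin> T'" "slack h x S' T' = 0"
    | "i \<notin> T'" "j \<in> S'" "slack h x S' T' = 0"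
    using lt pos gr nn d by (auto simp: vsum_axis vsum_add of_bool_def split: if_splits)
  then show ?thesis
  proof cases
    case 1
    then show ?thesis
      using infeasible_combination [OF h g x t d] that i iT d by auto
  next
    case 2
    then have "tight h x S' T'" using d by (simp add: tight_def)
    with 2 show ?thesis using that by blast
  next
    case 3
    then have "tight h x S' T'" using d by (simp add: tight_def)
    with 3 show ?thesis using tight_union_inter(1) [OF h x t] that i iT by auto
  qed
qed

section \<open>The least tight pair containing a given index\<close>

text \<open>Intersecting two tight pairs with \<open>i\<close> in the first component gives another
  one, so a pair of minimum total cardinality lies below all of them.\<close>

lemma minimal_tight_pair:
  assumes h: "bisubmodular h" and x: "x \<in> bisub_polyhedron h"
    and ex: "tight h x S0 T0" "i \<in> S0"
  obtains S T where "tight h x S T" "i \<in> S"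
    "\<And>S' T'. tight h x S' T' \<Longrightarrow> i \<in> S' \<Longrightarrow> S \<subseteq> S' \<and> T \<subseteq> T'"
proof -
  let ?P = "\<lambda>p. tight h x (fst p) (snd p) \<and> i \<in> fst p"
  have "?P (S0, T0)" using ex by simp
  then obtain p where p: "?P p"
    and min: "\<And>q. ?P q \<Longrightarrow> card (fst p) + card (snd p) \<le> card (fst q) + card (snd q)"
    using ex_has_least_nat [of ?P _ "\<lambda>p. card (fst p) + card (snd p)"] by blast
  obtain S T where ST: "p = (S, T)" by (cases p)
  have "S \<subseteq> S' \<and> T \<subseteq> T'" if q: "tight h x S' T'" "i \<in> S'" for S' T'
  proof -
    have "?P (S \<inter> S', T \<inter> T')"
      using tight_union_inter(2) [OF h x _ q(1)] p q ST by auto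
    from min [OF this] have le: "card S + card T \<le> card (S \<inter> S') + card (T \<inter> T')"
      by (simp add: ST)
    have "card (S \<inter> S') \<le> card S" "card (T \<inter> T') \<le> card T"
      by (simp_all add: card_mono)
    with le have "card (S \<inter> S') = card S" "card (T \<inter> T') = card T"
      by linarith+
    then have "S \<inter> S' = S" "T \<inter> T' = T"
      by (simp_all add: card_subset_eq)
    then show ?thesis by blast
  qed
  then show ?thesis using that p ST by auto
qed

text \<open>An infeasible exchange with \<open>j\<close> would yield a tight pair that has
  \<open>i\<close> in its first component and omits \<open>j\<close> from the component in question,
  contradicting leastness.\<close>

lemma tight_pair_with_exchanges:
  assumes h: "bisubmodular h" and g: "granular h x \<epsilon>" and x: "x \<in> bisub_polyhedron h"
    and inf: "x + \<epsilon> *\<^sub>R axis i 1 \<notin> bisub_polyhedron h"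
  obtains S T where "tight h x S T" "i \<in> S"
    "\<And>j. j \<in> S \<Longrightarrow> j \<noteq> i \<Longrightarrow> x + \<epsilon> *\<^sub>R (axis i 1 - axis j 1) \<in> bisub_polyhedron h"
    "\<And>j. j \<in> T \<Longrightarrow> x + \<epsilon> *\<^sub>R (axis i 1 + axis j 1) \<in> bisub_polyhedron h"
proof -
  obtain S T where t: "tight h x S T" and i: "i \<in> S"
    and min: "\<And>S' T'. tight h x S' T' \<Longrightarrow> i \<in> S' \<Longrightarrow> S \<subseteq> S' \<and> T \<subseteq> T'"
    using infeasible_axis_imp_tight [OF g x inf] minimal_tight_pair [OF h x] by metis
  have "x + \<epsilon> *\<^sub>R (axis i 1 - axis j 1) \<in> bisub_polyhedron h" if "j \<in> S" "j \<noteq> i" for j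
    using infeasible_axis_diff_imp_tight [OF h g x t i that(2)] min that(1) by blast
  moreover have "x + \<epsilon> *\<^sub>R (axis i 1 + axis j 1) \<in> bisub_polyhedron h" if "j \<in> T" for j
  proof -
    have "j \<noteq> i" using that t i by (auto simp: tight_def)
    then show ?thesis
      using infeasible_axis_add_imp_tight [OF h g x t i] min that by blast
  qed
  ultimately show ?thesis using that t i by blast
qed

section \<open>Level sets of a locally optimal point\<close>

definition quad_cost :: "real ^ 'n::finite \<Rightarrow> real ^ 'n \<Rightarrow> real ^ 'n \<Rightarrow> real" where
  "quad_cost a b x = (\<Sum>i\<in>UNIV. 1 / 2 * ((x $ i + b $ i)\<^sup>2 / a $ i))"

text \<open>The expansion is exact. The second-order term is kept because the integral case takes
  \<open>\<epsilon> = 1\<close>, where it is not negligible.\<close>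

lemma quad_cost_step:
  fixes a :: "real ^ 'n::finite"
  assumes "\<forall>i. a $ i > 0"
  shows "quad_cost a b (x + \<epsilon> *\<^sub>R d) - quad_cost a b x
    = \<epsilon> * (\<Sum>k\<in>UNIV. d $ k * ((x $ k + b $ k) / a $ k) + \<epsilon> / 2 * ((d $ k)\<^sup>2 / a $ k))"
  unfolding quad_cost_def sum_subtractf [symmetric] sum_distrib_left
proof (rule sum.cong [OF refl])
  fix k
  have "a $ k \<noteq> 0" using assms by (metis less_irrefl)
  then show "1 / 2 * (((x + \<epsilon> *\<^sub>R d) $ k + b $ k)\<^sup>2 / a $ k) - 1 / 2 * ((x $ k + b $ k)\<^sup>2 / a $ k)
    = \<epsilon> * (d $ k * ((x $ k + b $ k) / a $ k) + \<epsilon> / 2 * ((d $ k)\<^sup>2 / a $ k))"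
    by (simp add: field_simps power2_eq_square)
qed

lemma sum_axis_pair:
  fixes f :: "'n::finite \<Rightarrow> real \<Rightarrow> real"
  assumes "\<And>k. f k 0 = 0" "i \<noteq> j"
  shows "(\<Sum>k\<in>UNIV. f k ((axis i 1 + \<sigma> *\<^sub>R axis j 1) $ k)) = f i 1 + f j \<sigma>"
proof -
  have "(\<Sum>k\<in>UNIV. f k ((axis i 1 + \<sigma> *\<^sub>R axis j 1) $ k))
    = (\<Sum>k\<in>{i, j}. f k ((axis i 1 + \<sigma> *\<^sub>R axis j 1) $ k))"
    by (rule sum.mono_neutral_right) (auto simp: axis_def assms(1))
  then show ?thesis using assms(2) by (simp add: axis_def)
qed

lemma sum_axis:
  fixes f :: "'n::finite \<Rightarrow> real \<Rightarrow> real"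
  assumes "\<And>k. f k 0 = 0"
  shows "(\<Sum>k\<in>UNIV. f k (axis i 1 $ k)) = f i 1"
proof -
  have "(\<Sum>k\<in>UNIV. f k (axis i 1 $ k)) = (\<Sum>k\<in>{i}. f k (axis i 1 $ k))"
    by (rule sum.mono_neutral_right) (auto simp: axis_def assms)
  then show ?thesis by (simp add: axis_def)
qed

text \<open>Directions are restricted to integral ones so that both cases fit: for
  \<open>\<epsilon> = 1\<close> and integral \<open>x\<close>, the competitors are integral points,
  and the exchange directions are integral anyway.\<close>

definition locally_optimal ::
  "('n::finite set \<times> 'n set \<Rightarrow> real) \<Rightarrow> real ^ 'n \<Rightarrow> real ^ 'n \<Rightarrow> real \<Rightarrow> real ^ 'n \<Rightarrow> bool" where
  "locally_optimal h a b \<epsilon> x \<longleftrightarrow> x \<in> bisub_polyhedron h \<and>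
     (\<forall>d. integral_vec d \<and> x + \<epsilon> *\<^sub>R d \<in> bisub_polyhedron h
        \<longrightarrow> quad_cost a b x \<le> quad_cost a b (x + \<epsilon> *\<^sub>R d))"

lemma integral_vec_axis: "integral_vec (axis i 1)"
  and integral_vec_add: "integral_vec x \<Longrightarrow> integral_vec y \<Longrightarrow> integral_vec (x + y)"
  and integral_vec_minus: "integral_vec x \<Longrightarrow> integral_vec (- x)"
  by (simp_all add: integral_vec_def axis_def)

lemma locally_optimal_axis:
  fixes a :: "real ^ 'n::finite"
  assumes "locally_optimal h a b \<epsilon> x" "\<epsilon> > 0" "\<forall>i. a $ i > 0"
    and "x + \<epsilon> *\<^sub>R axis i 1 \<in> bisub_polyhedron h"
  shows "(x $ i + b $ i) / a $ i + \<epsilon> / 2 * (1 / a $ i) \<ge> 0"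
proof -
  have "0 \<le> \<epsilon> * ((x $ i + b $ i) / a $ i + \<epsilon> / 2 * (1 / a $ i))"
    using assms(1,4) integral_vec_axis quad_cost_step [OF assms(3), of b x \<epsilon> "axis i 1"]
      sum_axis [of "\<lambda>k t. t * ((x $ k + b $ k) / a $ k) + \<epsilon> / 2 * (t\<^sup>2 / a $ k)" i]
    unfolding locally_optimal_def by fastforce
  with assms(2) show ?thesis by (simp add: zero_le_mult_iff)
qed

lemma locally_optimal_axis_pair:
  fixes a :: "real ^ 'n::finite"
  assumes "locally_optimal h a b \<epsilon> x" "\<epsilon> > 0" "\<forall>i. a $ i > 0"
    and "i \<noteq> j" "\<sigma> \<in> {1, -1}"
    and "x + \<epsilon> *\<^sub>R (axis i 1 + \<sigma> *\<^sub>R axis j 1) \<in> bisub_polyhedron h"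
  shows "(x $ i + b $ i) / a $ i + \<sigma> * ((x $ j + b $ j) / a $ j)
    + \<epsilon> / 2 * (1 / a $ i + 1 / a $ j) \<ge> 0"
proof -
  have "integral_vec (axis i 1 + \<sigma> *\<^sub>R axis j 1)"
    using assms(5) by (auto simp: integral_vec_def axis_def)
  then have "0 \<le> quad_cost a b (x + \<epsilon> *\<^sub>R (axis i 1 + \<sigma> *\<^sub>R axis j 1)) - quad_cost a b x"
    using assms(1,6) unfolding locally_optimal_def by auto
  also have "\<dots> = \<epsilon> * ((x $ i + b $ i) / a $ i + \<epsilon> / 2 * (1 / a $ i)
      + (\<sigma> * ((x $ j + b $ j) / a $ j) + \<epsilon> / 2 * (\<sigma>\<^sup>2 / a $ j)))"
    unfolding quad_cost_step [OF assms(3)]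
    by (subst sum_axis_pair [where f = "\<lambda>k t. t * ((x $ k + b $ k) / a $ k) + \<epsilon> / 2 * (t\<^sup>2 / a $ k)"])
      (use assms(4) in auto)
  finally have "0 \<le> (x $ i + b $ i) / a $ i + \<epsilon> / 2 * (1 / a $ i)
      + (\<sigma> * ((x $ j + b $ j) / a $ j) + \<epsilon> / 2 * (\<sigma>\<^sup>2 / a $ j))"
    using assms(2) by (simp add: zero_le_mult_iff)
  moreover have "\<sigma>\<^sup>2 = 1" using assms(5) by auto
  ultimately show ?thesis by (simp add: algebra_simps)
qed

text \<open>Optimality against a feasible exchange bounds \<open>z i - z j\<close> or
  \<open>z i + z j\<close> from below, up to a second-order error of at most
  \<open>\<epsilon> * \<kappa>\<close>. The margin in the assumption on \<open>z i\<close> absorbs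
  this error, so the level bounds hold with \<open>c\<close> itself.\<close>

lemma tight_pair_below:
  fixes a b x :: "real ^ 'n::finite"
  defines "z \<equiv> \<lambda>i. (x $ i + b $ i) / a $ i"
  assumes h: "bisubmodular h" and g: "granular h x \<epsilon>" and a: "\<forall>i. a $ i > 0"
    and opt: "locally_optimal h a b \<epsilon> x"
    and \<kappa>: "\<And>i. 1 / a $ i \<le> \<kappa>"
    and c: "c \<ge> 0" and i: "z i + \<epsilon> * \<kappa> \<le> - c"
  obtains S T where "tight h x S T" "i \<in> S" "\<And>j. j \<in> S \<Longrightarrow> z j \<le> - c" "\<And>j. j \<in> T \<Longrightarrow> z j \<ge> c"
proof -
  have \<epsilon>: "\<epsilon> > 0" using g by (simp add: granular_def)
  have x: "x \<in> bisub_polyhedron h" using opt by (simp add: locally_optimal_def)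
  have pos: "1 / a $ k > 0" for k using a by simp
  have \<kappa>0: "\<kappa> > 0" using pos [of i] \<kappa> [of i] by linarith
  \<comment> \<open>Since \<open>z i\<close> lies at least \<open>\<epsilon> * \<kappa>\<close>
    below 0, raising \<open>x $ i\<close> would strictly lower the cost.\<close>
  have "x + \<epsilon> *\<^sub>R axis i 1 \<notin> bisub_polyhedron h"
  proof
    assume "x + \<epsilon> *\<^sub>R axis i 1 \<in> bisub_polyhedron h"
    from locally_optimal_axis [OF opt \<epsilon> a this]
    have "z i + \<epsilon> / 2 * (1 / a $ i) \<ge> 0" by (simp add: z_def)
    moreover have "\<epsilon> / 2 * (1 / a $ i) \<le> \<epsilon> / 2 * \<kappa>"
      using \<kappa> \<epsilon> by (intro mult_left_mono) auto
    moreover have "\<epsilon> * \<kappa> > 0" using \<epsilon> \<kappa>0 by simp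
    ultimately show False using i c by (simp add: field_simps)
  qed
  then obtain S T where t: "tight h x S T" "i \<in> S"
    and m: "\<And>j. j \<in> S \<Longrightarrow> j \<noteq> i \<Longrightarrow> x + \<epsilon> *\<^sub>R (axis i 1 - axis j 1) \<in> bisub_polyhedron h"
    and p: "\<And>j. j \<in> T \<Longrightarrow> x + \<epsilon> *\<^sub>R (axis i 1 + axis j 1) \<in> bisub_polyhedron h"
    using tight_pair_with_exchanges [OF h g x] by metis
  have sum: "\<epsilon> / 2 * (1 / a $ i + 1 / a $ j) \<le> \<epsilon> * \<kappa>" for j
    using mult_left_mono [of "1 / a $ i + 1 / a $ j" "2 * \<kappa>" "\<epsilon> / 2"] \<kappa> [of i] \<kappa> [of j] \<epsilon> by simp
  have "z j \<le> - c" if "j \<in> S" for j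
  proof (cases "j = i")
    case True
    then show ?thesis using i \<epsilon> \<kappa>0 by (smt (verit) mult_pos_pos)
  next
    case False
    have "z i - z j + \<epsilon> / 2 * (1 / a $ i + 1 / a $ j) \<ge> 0"
      using locally_optimal_axis_pair [OF opt \<epsilon> a, of i j "-1"] m [OF that False] False
      by (simp add: z_def diff_divide_distrib add_divide_distrib)
    then show ?thesis using sum [of j] i by linarith
  qed
  moreover have "z j \<ge> c" if "j \<in> T" for j
  proof -
    have "i \<noteq> j" using that t by (auto simp: tight_def)
    then have "z i + z j + \<epsilon> / 2 * (1 / a $ i + 1 / a $ j) \<ge> 0"
      using locally_optimal_axis_pair [OF opt \<epsilon> a, of i j 1] p [OF that] by (simp add: z_def)
    then show ?thesis using sum [of j] i by linarith
  qed
  ultimately show ?thesis using that t by blast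
qed

section \<open>Reflection: exchanging the components and negating the point\<close>

lemma reflect_slack: "slack (\<lambda>(S, T). h (T, S)) (- x) S T = slack h x T S"
  by (simp add: slack_def vsum_def sum_negf)

lemma reflect_tight: "tight (\<lambda>(S, T). h (T, S)) (- x) S T \<longleftrightarrow> tight h x T S"
  by (auto simp: tight_def reflect_slack)

lemma reflect_polyhedron:
  "- x \<in> bisub_polyhedron (\<lambda>(S, T). h (T, S)) \<longleftrightarrow> x \<in> bisub_polyhedron h"
  unfolding bisub_polyhedron_iff_slack reflect_slack by (metis inf_commute)

lemma reflect_granular: "granular h x \<epsilon> \<Longrightarrow> granular (\<lambda>(S, T). h (T, S)) (- x) \<epsilon>"
  unfolding granular_def reflect_slack by (metis inf_commute)

lemma reflect_bisubmodular: "bisubmodular h \<Longrightarrow> bisubmodular (\<lambda>(S, T). h (T, S))"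
  unfolding bisubmodular_def disjoint_pairs_def
  by (auto simp: Int_commute)

lemma quad_cost_minus: "quad_cost a (- b) (- x) = quad_cost a b x"
proof -
  have "(- x $ i + - b $ i)\<^sup>2 = (x $ i + b $ i)\<^sup>2" for i
    by (simp add: power2_eq_square algebra_simps)
  then show ?thesis by (simp add: quad_cost_def)
qed

lemma reflect_locally_optimal:
  assumes "locally_optimal h a b \<epsilon> x"
  shows "locally_optimal (\<lambda>(S, T). h (T, S)) a (- b) \<epsilon> (- x)"
  unfolding locally_optimal_def
proof (intro conjI allI impI)
  show "- x \<in> bisub_polyhedron (\<lambda>(S, T). h (T, S))"
    using assms by (simp add: locally_optimal_def reflect_polyhedron)
next
  fix d assume d: "integral_vec d \<and> - x + \<epsilon> *\<^sub>R d \<in> bisub_polyhedron (\<lambda>(S, T). h (T, S))"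
  have eq: "- x + \<epsilon> *\<^sub>R d = - (x + \<epsilon> *\<^sub>R (- d))" by simp
  show "quad_cost a (- b) (- x) \<le> quad_cost a (- b) (- x + \<epsilon> *\<^sub>R d)"
    using d assms integral_vec_minus
    unfolding eq quad_cost_minus reflect_polyhedron locally_optimal_def by blast
qed

text \<open>Swapping the components of each pair and negating \<open>x\<close> and \<open>b\<close>
  preserves tightness and local optimality and turns \<open>z\<close> into its negative, which
  reduces this to \<open>tight_pair_below\<close>.\<close>

lemma tight_pair_above:
  fixes a b x :: "real ^ 'n::finite"
  defines "z \<equiv> \<lambda>i. (x $ i + b $ i) / a $ i"
  assumes h: "bisubmodular h" and g: "granular h x \<epsilon>" and a: "\<forall>i. a $ i > 0"
    and opt: "locally_optimal h a b \<epsilon> x"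
    and \<kappa>: "\<And>i. 1 / a $ i \<le> \<kappa>"
    and c: "c \<ge> 0" and i: "z i - \<epsilon> * \<kappa> \<ge> c"
  obtains S T where "tight h x S T" "i \<in> T" "\<And>j. j \<in> S \<Longrightarrow> z j \<le> - c" "\<And>j. j \<in> T \<Longrightarrow> z j \<ge> c"
proof -
  have neg: "((- x) $ j + (- b) $ j) / a $ j = - z j" for j
    by (simp add: z_def add_divide_distrib diff_divide_distrib)
  show ?thesis
  proof (rule tight_pair_below [OF reflect_bisubmodular [OF h] reflect_granular [OF g] a
        reflect_locally_optimal [OF opt] \<kappa> c, of i, unfolded neg reflect_tight])
    show "- z i + \<epsilon> * \<kappa> \<le> - c" using i by simp
  next
    fix S T
    assume "tight h x T S" "i \<in> S" "\<And>j. j \<in> S \<Longrightarrow> - z j \<le> - c" "\<And>j. j \<in> T \<Longrightarrow> c \<le> - z j"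
    then show thesis by (intro that [of T S]) (auto simp: le_minus_iff)
  qed
qed

text \<open>By the gap assumption, each index with \<open>\<bar>z i\<bar> > c\<close> has the margin
  required for its own tight pair. Finitely many such pairs are joined by the reduced union.\<close>

lemma tight_level_pair:
  fixes a b x :: "real ^ 'n::finite"
  defines "z \<equiv> \<lambda>i. (x $ i + b $ i) / a $ i"
  assumes h: "bisubmodular h" and g: "granular h x \<epsilon>" and a: "\<forall>i. a $ i > 0"
    and opt: "locally_optimal h a b \<epsilon> x"
    and \<kappa>: "\<And>i. 1 / a $ i \<le> \<kappa>"
    and c: "c \<ge> 0" and gap: "\<And>i. \<bar>z i\<bar> > c \<Longrightarrow> \<bar>z i\<bar> \<ge> c + \<epsilon> * \<kappa>"
  obtains S T where "tight h x S T"
    "\<And>j. j \<in> S \<Longrightarrow> z j \<le> - c" "\<And>j. j \<in> T \<Longrightarrow> z j \<ge> c"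
    "\<And>j. \<bar>z j\<bar> > c \<Longrightarrow> j \<in> S \<union> T"
proof -
  have x: "x \<in> bisub_polyhedron h" using opt by (simp add: locally_optimal_def)
  have single: "\<exists>S T. tight h x S T \<and> i \<in> S \<union> T \<and> (\<forall>j\<in>S. z j \<le> - c) \<and> (\<forall>j\<in>T. z j \<ge> c)"
    if i: "\<bar>z i\<bar> > c" for i
  proof (cases "z i < 0")
    case True
    then have "z i + \<epsilon> * \<kappa> \<le> - c" using gap [OF i] by linarith
    then show ?thesis
      using tight_pair_below [OF h g a opt \<kappa> c, of i] unfolding z_def by (metis UnI1)
  next
    case False
    then have "z i - \<epsilon> * \<kappa> \<ge> c" using gap [OF i] by linarith
    then show ?thesis
      using tight_pair_above [OF h g a opt \<kappa> c, of i] unfolding z_def by (metis UnI2)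
  qed
  have "\<exists>S T. tight h x S T \<and> I \<subseteq> S \<union> T \<and> (\<forall>j\<in>S. z j \<le> - c) \<and> (\<forall>j\<in>T. z j \<ge> c)"
    if "finite I" "I \<subseteq> {i. \<bar>z i\<bar> > c}" for I
    using that
  proof (induction I)
    case empty
    then show ?case using tight_empty [OF h] by blast
  next
    case (insert i I)
    then obtain S T where 1: "tight h x S T" "I \<subseteq> S \<union> T" "\<forall>j\<in>S. z j \<le> - c" "\<forall>j\<in>T. z j \<ge> c"
      by auto
    obtain S' T' where 2: "tight h x S' T'" "i \<in> S' \<union> T'" "\<forall>j\<in>S'. z j \<le> - c" "\<forall>j\<in>T'. z j \<ge> c"
      using single [of i] insert.prems by auto
    \<comment> \<open>For \<open>c = 0\<close> the two pairs may be inconsistent, but only where \<open>z\<close> vanishes.\<close>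
    have "insert i I \<subseteq> ((S \<union> S') - (T \<union> T')) \<union> ((T \<union> T') - (S \<union> S'))"
    proof
      fix j assume j: "j \<in> insert i I"
      then have "\<bar>z j\<bar> > c" using insert.prems by auto
      then have "\<not> (z j \<le> - c \<and> z j \<ge> c)" using c by linarith
      then show "j \<in> ((S \<union> S') - (T \<union> T')) \<union> ((T \<union> T') - (S \<union> S'))"
        using j 1(2-4) 2(2-4) by blast
    qed
    moreover have "tight h x ((S \<union> S') - (T \<union> T')) ((T \<union> T') - (S \<union> S'))"
      by (rule tight_union_inter(1) [OF h x 1(1) 2(1)])
    moreover have "\<forall>j\<in>(S \<union> S') - (T \<union> T'). z j \<le> - c" "\<forall>j\<in>(T \<union> T') - (S \<union> S'). z j \<ge> c"
      using 1(3,4) 2(3,4) by auto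
    ultimately show ?case by blast
  qed
  from this [of "{i. \<bar>z i\<bar> > c}"] show ?thesis using that by (auto simp: subset_iff)
qed

section \<open>Comparison of hinge sums and decomposition of even convex functions\<close>

text \<open>The negated signs of the pair are subgradients of the hinge at \<open>z i\<close>.
  Tightness at \<open>x\<close> and feasibility of \<open>y\<close> make the summed linear term
  nonnegative.\<close>

lemma tight_hinge_le:
  fixes a b x :: "real ^ 'n::finite"
  assumes t: "tight h x S T" and y: "y \<in> bisub_polyhedron h" and a: "\<forall>i. a $ i > 0"
    and c: "c \<ge> 0"
    and S: "\<And>j. j \<in> S \<Longrightarrow> (x $ j + b $ j) / a $ j \<le> - c"
    and T: "\<And>j. j \<in> T \<Longrightarrow> (x $ j + b $ j) / a $ j \<ge> c"
    and cover: "\<And>j. \<bar>(x $ j + b $ j) / a $ j\<bar> > c \<Longrightarrow> j \<in> S \<union> T"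
  shows "(\<Sum>i\<in>UNIV. a $ i * max 0 (\<bar>(x $ i + b $ i) / a $ i\<bar> - c))
    \<le> (\<Sum>i\<in>UNIV. a $ i * max 0 (\<bar>(y $ i + b $ i) / a $ i\<bar> - c))"
proof -
  have d: "S \<inter> T = {}" using t by (simp add: tight_def)
  define s :: "'n \<Rightarrow> real" where "s i = of_bool (i \<in> S) - of_bool (i \<in> T)" for i
  have "slack h y S T \<ge> 0" "slack h x S T = 0"
    using y t by (auto simp: bisub_polyhedron_iff_slack tight_def)
  then have "vsum y S - vsum y T \<le> vsum x S - vsum x T" by (simp add: slack_def)
  then have "0 \<le> (\<Sum>i\<in>UNIV. (x $ i - y $ i) * s i)"
    unfolding s_def vsum_diff_eq_sum by (simp add: left_diff_distrib sum_subtractf)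
  also have "\<dots> \<le> (\<Sum>i\<in>UNIV. a $ i * max 0 (\<bar>(y $ i + b $ i) / a $ i\<bar> - c)
      - a $ i * max 0 (\<bar>(x $ i + b $ i) / a $ i\<bar> - c))"
  proof (rule sum_mono)
    fix i
    define z w where "z = (x $ i + b $ i) / a $ i" and "w = (y $ i + b $ i) / a $ i"
    have ai: "a $ i > 0" using a by simp
    \<comment> \<open>Subgradient inequality: the slope \<open>- s i\<close> is -1 where
      \<open>z \<le> - c\<close>, 1 where \<open>z \<ge> c\<close>, and 0 where
      \<open>\<bar>z\<bar> \<le> c\<close>. At a kink either adjacent slope is valid.\<close>
    have "(z - w) * s i \<le> max 0 (\<bar>w\<bar> - c) - max 0 (\<bar>z\<bar> - c)"
    proof -
      consider "i \<in> S" "i \<notin> T" "z \<le> - c" | "i \<notin> S" "i \<in> T" "z \<ge> c"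
        | "i \<notin> S" "i \<notin> T" "\<bar>z\<bar> \<le> c"
        using S [of i] T [of i] cover [of i] d unfolding z_def by fastforce
      then show ?thesis
      proof cases
        case 1
        then have "s i = 1" by (simp add: s_def)
        then show ?thesis using 1 c by simp
      next
        case 2
        then have "s i = - 1" by (simp add: s_def)
        then show ?thesis using 2 c by simp
      next
        case 3
        then have "s i = 0" by (simp add: s_def)
        then show ?thesis using 3 by simp
      qed
    qed
    then have "a $ i * ((z - w) * s i) \<le> a $ i * (max 0 (\<bar>w\<bar> - c) - max 0 (\<bar>z\<bar> - c))"
      using ai by simp
    moreover have "a $ i * (z - w) = x $ i - y $ i"
      using ai by (simp add: z_def w_def right_diff_distrib)
    ultimately show "(x $ i - y $ i) * s i \<le> a $ i * max 0 (\<bar>(y $ i + b $ i) / a $ i\<bar> - c)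
      - a $ i * max 0 (\<bar>(x $ i + b $ i) / a $ i\<bar> - c)"
      unfolding z_def [symmetric] w_def [symmetric]
      by (metis mult.assoc right_diff_distrib)
  qed
  finally show ?thesis by (simp add: sum_subtractf)
qed

section \<open>Hinge decomposition of even convex functions\<close>

lemma even_convex_ge_zero:
  fixes \<phi> :: "real \<Rightarrow> real"
  assumes "\<And>t. \<phi> (- t) = \<phi> t" "convex_on UNIV \<phi>"
  shows "\<phi> 0 \<le> \<phi> t"
  using convex_onD [OF assms(2), of "1/2" t "- t"] assms(1) [of t] by simp

text \<open>On a finite set \<open>insert 0 V\<close>, an even convex function is a nonnegative combination of hinges
  with kinks in that set. The induction adds points from left to right; the last slope \<open>s\<close> and
  the last point \<open>p\<close> determine the weight of the next hinge.\<close>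

lemma even_convex_hinges:
  fixes \<phi> :: "real \<Rightarrow> real"
  assumes even: "\<And>t. \<phi> (- t) = \<phi> t" and cvx: "convex_on UNIV \<phi>"
    and V: "finite V" "\<And>v. v \<in> V \<Longrightarrow> v > 0"
  obtains u where "\<And>c. u c \<ge> 0"
    "\<And>v. v \<in> insert 0 V \<Longrightarrow> \<phi> v = \<phi> 0 + (\<Sum>c\<in>insert 0 V. u c * max 0 (v - c))"
proof -
  \<comment> \<open>The invariant adds that from the largest point \<open>p\<close> on the
    combination is a line of slope \<open>s\<close> lying below the function. This makes the next
    weight nonnegative.\<close>
  have "\<exists>u s p. (\<forall>c. u c \<ge> 0) \<and> p \<in> insert 0 V \<and> (\<forall>v\<in>insert 0 V. v \<le> p) \<and>
    (\<forall>v\<in>insert 0 V. \<phi> v = \<phi> 0 + (\<Sum>c\<in>insert 0 V. u c * max 0 (v - c))) \<and>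
    (\<forall>v\<ge>p. \<phi> 0 + (\<Sum>c\<in>insert 0 V. u c * max 0 (v - c)) = \<phi> p + s * (v - p)) \<and>
    (\<forall>v\<ge>p. \<phi> p + s * (v - p) \<le> \<phi> v)"
    using V
  proof (induction V rule: finite_linorder_max_induct)
    case empty
    show ?case
      \<comment> \<open>Here \<open>s = 0\<close> and \<open>p = 0\<close>: the constant line at
        height \<open>\<phi> 0\<close> lies below \<open>\<phi>\<close>.\<close>
      by (intro exI [of _ "\<lambda>_. 0"] exI [of _ 0])
        (use even_convex_ge_zero [OF even cvx] in auto)
  next
    case (insert m V)
    then obtain u s p where u: "\<forall>c. u c \<ge> 0" and p: "p \<in> insert 0 V" "\<forall>v\<in>insert 0 V. v \<le> p"
      and eq: "\<forall>v\<in>insert 0 V. \<phi> v = \<phi> 0 + (\<Sum>c\<in>insert 0 V. u c * max 0 (v - c))"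
      and aff: "\<forall>v\<ge>p. \<phi> 0 + (\<Sum>c\<in>insert 0 V. u c * max 0 (v - c)) = \<phi> p + s * (v - p)"
      and le: "\<forall>v\<ge>p. \<phi> p + s * (v - p) \<le> \<phi> v"
      by auto
    have m: "m > p" "m \<notin> insert 0 V"
      using p(1) insert.hyps insert.prems by auto
    define s' where "s' = (\<phi> m - \<phi> p) / (m - p)"
    have s': "s' * (m - p) = \<phi> m - \<phi> p" using m by (simp add: s'_def)
    have "s * (m - p) \<le> s' * (m - p)"
      using le [rule_format, of m] m s' by simp
    then have ss': "s \<le> s'" using m by simp
    \<comment> \<open>The slope change from \<open>s\<close> to \<open>s'\<close> is placed at the
      old point \<open>p\<close>, so that beyond \<open>p\<close> the combination follows the chord
      through \<open>p\<close> and \<open>m\<close>. The new point \<open>m\<close> gets weight 0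
      until a later point is added.\<close>
    define u' where "u' = (\<lambda>c. if c = m then 0 else if c = p then u c + (s' - s) else u c)"
    have fin: "finite (insert 0 V)" using insert.hyps by simp
    have sum': "(\<Sum>c\<in>insert 0 (insert m V). u' c * max 0 (v - c))
        = (\<Sum>c\<in>insert 0 V. u c * max 0 (v - c)) + (s' - s) * max 0 (v - p)" for v
    proof -
      have "(\<Sum>c\<in>insert 0 (insert m V). u' c * max 0 (v - c))
          = (\<Sum>c\<in>insert m (insert 0 V). u' c * max 0 (v - c))"
        by (simp only: insert_commute)
      also have "\<dots> = (\<Sum>c\<in>insert 0 V. u' c * max 0 (v - c))"
        using fin m(2) by (subst sum.insert) (auto simp: u'_def)
      also have "\<dots> = (\<Sum>c\<in>insert 0 V. u c * max 0 (v - c)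
          + (if c = p then (s' - s) * max 0 (v - c) else 0))"
        using m(2) by (intro sum.cong) (auto simp: u'_def distrib_right)
      also have "\<dots> = (\<Sum>c\<in>insert 0 V. u c * max 0 (v - c)) + (s' - s) * max 0 (v - p)"
        unfolding sum.distrib using fin p(1) by (simp only: sum.delta) simp
      finally show ?thesis .
    qed
    have aff': "\<phi> 0 + (\<Sum>c\<in>insert 0 (insert m V). u' c * max 0 (v - c)) = \<phi> m + s' * (v - m)"
      if "v \<ge> p" for v
    proof -
      have "\<phi> 0 + (\<Sum>c\<in>insert 0 (insert m V). u' c * max 0 (v - c)) = \<phi> p + s' * (v - p)"
        using aff that unfolding sum' by (simp add: algebra_simps)
      also have "\<dots> = \<phi> m + s' * (v - m)" using s' by (simp add: algebra_simps)
      finally show ?thesis .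
    qed
    show ?case
    proof (rule exI [of _ u'], rule exI [of _ s'], rule exI [of _ m], intro conjI)
      show "\<forall>c. u' c \<ge> 0" using u ss' by (auto simp: u'_def intro: add_nonneg_nonneg)
      show "m \<in> insert 0 (insert m V)" by simp
      show "\<forall>v\<in>insert 0 (insert m V). v \<le> m" using p(2) m by fastforce
      show "\<forall>v\<in>insert 0 (insert m V).
        \<phi> v = \<phi> 0 + (\<Sum>c\<in>insert 0 (insert m V). u' c * max 0 (v - c))"
      proof
        fix v assume "v \<in> insert 0 (insert m V)"
        then consider "v = m" | "v \<in> insert 0 V" by auto
        then show "\<phi> v = \<phi> 0 + (\<Sum>c\<in>insert 0 (insert m V). u' c * max 0 (v - c))"
        proof cases
          case 1
          then show ?thesis using aff' [of m] m by simp
        next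
          case 2
          then have "v \<le> p" using p by blast
          with 2 show ?thesis using eq [rule_format, of v] unfolding sum' by simp
        qed
      qed
      show "\<forall>v\<ge>m. \<phi> 0 + (\<Sum>c\<in>insert 0 (insert m V). u' c * max 0 (v - c)) = \<phi> m + s' * (v - m)"
        using aff' m by simp
      show "\<forall>v\<ge>m. \<phi> m + s' * (v - m) \<le> \<phi> v"
      proof (intro allI impI)
        fix v assume v: "v \<ge> m"
        show "\<phi> m + s' * (v - m) \<le> \<phi> v"
        proof (cases "v = m")
          case False
          \<comment> \<open>This weight writes \<open>m\<close> as a convex combination of
            \<open>p\<close> and \<open>v\<close>. Convexity then bounds the chord slope from
            \<open>p\<close> to \<open>m\<close> by the one from \<open>p\<close> to
            \<open>v\<close>.\<close>
          define \<theta> where "\<theta> = (m - p) / (v - p)"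
          have vp: "v - p > 0" using v m by simp
          have \<theta>: "0 \<le> \<theta>" "\<theta> \<le> 1" using v m by (auto simp: \<theta>_def)
          have "\<theta> * (v - p) = m - p" using vp by (simp add: \<theta>_def)
          then have "(1 - \<theta>) * p + \<theta> * v = m" by (simp add: algebra_simps)
          then have "\<phi> m \<le> (1 - \<theta>) * \<phi> p + \<theta> * \<phi> v"
            using convex_onD [OF cvx \<theta>, of p v] by simp
          then have "\<phi> m - \<phi> p \<le> \<theta> * (\<phi> v - \<phi> p)"
            by (simp add: algebra_simps)
          then have "\<phi> m - \<phi> p \<le> (m - p) * (\<phi> v - \<phi> p) / (v - p)"
            by (simp add: \<theta>_def)
          then have "(\<phi> m - \<phi> p) * (v - p) \<le> (m - p) * (\<phi> v - \<phi> p)"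
            using vp by (simp add: pos_le_divide_eq)
          then have "(m - p) * (s' * (v - p)) \<le> (m - p) * (\<phi> v - \<phi> p)"
            using s' by (metis mult.assoc mult.commute)
          then have "s' * (v - p) \<le> \<phi> v - \<phi> p" using m by simp
          then show ?thesis using s' by (simp add: algebra_simps)
        qed simp
      qed
    qed
  qed
  then show ?thesis using that by blast
qed

text \<open>The hinge decomposition is taken on the absolute values of both vectors at once, so a
  single family of weights serves both sums. Restricting the kinks to these values makes them
  integers in the integral case.\<close>

lemma weakly_abs_majorizedI:
  fixes a b x y :: "real ^ 'n::finite"
  defines "z \<equiv> \<lambda>i. (x $ i + b $ i) / a $ i" and "w \<equiv> \<lambda>i. (y $ i + b $ i) / a $ i"
  assumes hinge: "\<And>c. c \<in> insert 0 (range (\<lambda>i. \<bar>z i\<bar>) \<union> range (\<lambda>i. \<bar>w i\<bar>)) \<Longrightarrow>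
    (\<Sum>i\<in>UNIV. a $ i * max 0 (\<bar>z i\<bar> - c)) \<le> (\<Sum>i\<in>UNIV. a $ i * max 0 (\<bar>w i\<bar> - c))"
  shows "weakly_abs_majorized a b x y"
  unfolding weakly_abs_majorized_def
proof (intro allI impI)
  fix \<phi> :: "real \<Rightarrow> real"
  assume "(\<forall>t. \<phi> (- t) = \<phi> t) \<and> continuous_on UNIV \<phi> \<and> convex_on UNIV \<phi>"
  then have even: "\<And>t. \<phi> (- t) = \<phi> t" and cvx: "convex_on UNIV \<phi>" by auto
  \<comment> \<open>\<open>even_convex_hinges\<close> expects positive points and puts 0 back
    itself.\<close>
  define V where "V = (range (\<lambda>i. \<bar>z i\<bar>) \<union> range (\<lambda>i. \<bar>w i\<bar>)) - {0}"
  have "finite V" "\<And>v. v \<in> V \<Longrightarrow> v > 0" by (auto simp: V_def)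
  then obtain u where u: "\<And>c. u c \<ge> 0"
    and eq: "\<And>v. v \<in> insert 0 V \<Longrightarrow> \<phi> v = \<phi> 0 + (\<Sum>c\<in>insert 0 V. u c * max 0 (v - c))"
    using even_convex_hinges [OF even cvx] by metis
  have abs: "\<phi> \<bar>t\<bar> = \<phi> t" for t by (simp add: even abs_if)
  have expand: "(\<Sum>i\<in>UNIV. a $ i * \<phi> (f i)) = (\<Sum>i\<in>UNIV. a $ i * \<phi> 0)
      + (\<Sum>c\<in>insert 0 V. u c * (\<Sum>i\<in>UNIV. a $ i * max 0 (\<bar>f i\<bar> - c)))"
    if f: "\<And>i. \<bar>f i\<bar> \<in> insert 0 V" for f :: "'n \<Rightarrow> real"
  proof -
    have "(\<Sum>i\<in>UNIV. a $ i * \<phi> (f i))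
      = (\<Sum>i\<in>UNIV. a $ i * (\<phi> 0 + (\<Sum>c\<in>insert 0 V. u c * max 0 (\<bar>f i\<bar> - c))))"
      by (intro sum.cong refl arg_cong2 [of _ _ _ _ "(*)"]) (metis eq [OF f] abs)
    also have "\<dots> = (\<Sum>i\<in>UNIV. a $ i * \<phi> 0)
      + (\<Sum>i\<in>UNIV. \<Sum>c\<in>insert 0 V. u c * (a $ i * max 0 (\<bar>f i\<bar> - c)))"
      unfolding distrib_left sum.distrib sum_distrib_left by (simp only: mult.left_commute)
    also have "(\<Sum>i\<in>UNIV. \<Sum>c\<in>insert 0 V. u c * (a $ i * max 0 (\<bar>f i\<bar> - c)))
      = (\<Sum>c\<in>insert 0 V. u c * (\<Sum>i\<in>UNIV. a $ i * max 0 (\<bar>f i\<bar> - c)))"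
      unfolding sum_distrib_left by (rule sum.swap)
    finally show ?thesis .
  qed
  have "(\<Sum>c\<in>insert 0 V. u c * (\<Sum>i\<in>UNIV. a $ i * max 0 (\<bar>z i\<bar> - c)))
    \<le> (\<Sum>c\<in>insert 0 V. u c * (\<Sum>i\<in>UNIV. a $ i * max 0 (\<bar>w i\<bar> - c)))"
    by (intro sum_mono mult_left_mono hinge u) (auto simp: V_def)
  then have "(\<Sum>i\<in>UNIV. a $ i * \<phi> (z i)) \<le> (\<Sum>i\<in>UNIV. a $ i * \<phi> (w i))"
    using expand [of z] expand [of w] by (auto simp: V_def)
  then show "(\<Sum>i\<in>UNIV. a $ i * \<phi> ((x $ i + b $ i) / a $ i))
      \<le> (\<Sum>i\<in>UNIV. a $ i * \<phi> ((y $ i + b $ i) / a $ i))"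
    unfolding z_def w_def .
qed

lemma locally_optimal_hinge_le:
  fixes a b x :: "real ^ 'n::finite"
  assumes h: "bisubmodular h" and a: "\<forall>i. a $ i > 0" and y: "y \<in> bisub_polyhedron h"
    and g: "granular h x \<epsilon>" and opt: "locally_optimal h a b \<epsilon> x"
    and \<kappa>: "\<And>i. 1 / a $ i \<le> \<kappa>" and c: "c \<ge> 0"
    and gap: "\<And>i. \<bar>(x $ i + b $ i) / a $ i\<bar> > c \<Longrightarrow> \<bar>(x $ i + b $ i) / a $ i\<bar> \<ge> c + \<epsilon> * \<kappa>"
  shows "(\<Sum>i\<in>UNIV. a $ i * max 0 (\<bar>(x $ i + b $ i) / a $ i\<bar> - c))
    \<le> (\<Sum>i\<in>UNIV. a $ i * max 0 (\<bar>(y $ i + b $ i) / a $ i\<bar> - c))"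
proof (rule tight_level_pair [OF h g a opt \<kappa> c])
  show "\<bar>(x $ i + b $ i) / a $ i\<bar> \<ge> c + \<epsilon> * \<kappa>" if "\<bar>(x $ i + b $ i) / a $ i\<bar> > c" for i
    using gap [OF that] .
qed (rule tight_hinge_le [OF _ y a c])

section \<open>The real and the integral case\<close>

lemma finite_positive_lower_bound:
  fixes A :: "real set"
  assumes "finite A"
  obtains \<epsilon> where "\<epsilon> > 0" "\<And>r. r \<in> A \<Longrightarrow> r > 0 \<Longrightarrow> \<epsilon> \<le> r"
proof
  \<comment> \<open>The element 1 keeps the set nonempty, so that its minimum exists.\<close>
  let ?A = "insert 1 {r \<in> A. r > 0}"
  show "Min ?A > 0" using assms by (subst Min_gr_iff) auto
  show "Min ?A \<le> r" if "r \<in> A" "r > 0" for r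
    using assms that by (intro Min_le) auto
qed

lemma real_arg_min_majorized:
  fixes a b x :: "real ^ 'n::finite"
  assumes h: "bisubmodular h" and a: "\<forall>i. a $ i > 0"
    and x: "x \<in> bisub_polyhedron h"
    and min: "\<And>y. y \<in> bisub_polyhedron h \<Longrightarrow> quad_cost a b x \<le> quad_cost a b y"
    and y: "y \<in> bisub_polyhedron h"
  shows "weakly_abs_majorized a b x y"
proof (rule weakly_abs_majorizedI)
  define z where "z i = (x $ i + b $ i) / a $ i" for i
  fix c assume "c \<in> insert 0 (range (\<lambda>i. \<bar>(x $ i + b $ i) / a $ i\<bar>)
    \<union> range (\<lambda>i. \<bar>(y $ i + b $ i) / a $ i\<bar>))"
  then have c: "c \<ge> 0" by auto
  define \<kappa> where "\<kappa> = Max (range (\<lambda>i. 1 / a $ i))"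
  have \<kappa>: "1 / a $ i \<le> \<kappa>" for i by (simp add: \<kappa>_def)
  have \<kappa>0: "\<kappa> > 0" using \<kappa> [of undefined] a by (smt (verit) divide_pos_pos)
  \<comment> \<open>A step size below every positive element of this finite set gives granularity
    (from the slacks) and the gap above \<open>c\<close> (from the scaled distances). It may depend
    on \<open>c\<close>, since the hinges are compared one at a time.\<close>
  define A where "A = range (\<lambda>(S, T). slack h x S T) \<union> range (\<lambda>i. (\<bar>z i\<bar> - c) / \<kappa>)"
  have "finite A" by (simp add: A_def)
  then obtain \<epsilon> where \<epsilon>: "\<epsilon> > 0" and le: "\<And>r. r \<in> A \<Longrightarrow> r > 0 \<Longrightarrow> \<epsilon> \<le> r"
    using finite_positive_lower_bound by blast
  have "slack h x S T = 0 \<or> slack h x S T \<ge> \<epsilon>" if "S \<inter> T = {}" for S T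
  proof -
    have "slack h x S T \<in> A" unfolding A_def by (rule UnI1, rule image_eqI [of _ _ "(S, T)"]) auto
    moreover have "slack h x S T \<ge> 0" using x that by (simp add: bisub_polyhedron_iff_slack)
    ultimately show ?thesis using le [of "slack h x S T"] by linarith
  qed
  then have g: "granular h x \<epsilon>" using \<epsilon> by (simp add: granular_def)
  have gap: "\<bar>z i\<bar> \<ge> c + \<epsilon> * \<kappa>" if "\<bar>z i\<bar> > c" for i
    using le [of "(\<bar>z i\<bar> - c) / \<kappa>"] \<kappa>0 that by (auto simp: A_def pos_le_divide_eq)
  have opt: "locally_optimal h a b \<epsilon> x"
    using x min by (simp add: locally_optimal_def)
  show "(\<Sum>i\<in>UNIV. a $ i * max 0 (\<bar>(x $ i + b $ i) / a $ i\<bar> - c))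
    \<le> (\<Sum>i\<in>UNIV. a $ i * max 0 (\<bar>(y $ i + b $ i) / a $ i\<bar> - c))"
    using locally_optimal_hinge_le [OF h a y g opt \<kappa> c] gap by (simp add: z_def)
qed

lemma Ints_less_imp_add1_le: "r < s \<Longrightarrow> r + 1 \<le> s" if "r \<in> \<int>" "s \<in> \<int>" for r s :: real
  using that by (auto elim!: Ints_cases)

text \<open>Here \<open>\<epsilon> = \<kappa> = 1\<close>: slacks, shifted coordinates and kinks are
  all integers, so every positive slack or distance is at least 1.\<close>

lemma integral_arg_min_majorized:
  fixes b x :: "real ^ 'n::finite"
  assumes h: "bisubmodular h" and hi: "integral_setfun h" and bi: "integral_vec b"
    and x: "x \<in> bisub_polyhedron_int h"
    and min: "\<And>y. y \<in> bisub_polyhedron_int h \<Longrightarrow> quad_cost 1 b x \<le> quad_cost 1 b y"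
    and y: "y \<in> bisub_polyhedron_int h"
  shows "weakly_abs_majorized 1 b x y"
proof (rule weakly_abs_majorizedI)
  have xB: "x \<in> bisub_polyhedron h" and xi: "integral_vec x"
    and yB: "y \<in> bisub_polyhedron h" and yi: "integral_vec y"
    using x y by (auto simp: bisub_polyhedron_int_def)
  fix c assume "c \<in> insert 0 (range (\<lambda>i. \<bar>(x $ i + b $ i) / 1 $ i\<bar>)
    \<union> range (\<lambda>i. \<bar>(y $ i + b $ i) / 1 $ i\<bar>))"
  then have c: "c \<ge> 0" "c \<in> \<int>" using xi yi bi by (auto simp: integral_vec_def)
  have "slack h x S T = 0 \<or> slack h x S T \<ge> 1" if "S \<inter> T = {}" for S T
  proof -
    have "slack h x S T \<in> \<int>"
      using hi xi that
      by (auto simp: slack_def vsum_def integral_setfun_def integral_vec_def disjoint_pairs_def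
          intro!: Ints_diff Ints_sum)
    moreover have "slack h x S T \<ge> 0" using xB that by (simp add: bisub_polyhedron_iff_slack)
    ultimately show ?thesis using Ints_less_imp_add1_le [of 0 "slack h x S T"] by fastforce
  qed
  then have g: "granular h x 1" by (simp add: granular_def)
  have opt: "locally_optimal h 1 b 1 x"
    using xB xi min integral_vec_add
    by (auto simp: locally_optimal_def bisub_polyhedron_int_def)
  have gap: "\<bar>(x $ i + b $ i) / 1 $ i\<bar> \<ge> c + 1 * 1" if "\<bar>(x $ i + b $ i) / 1 $ i\<bar> > c" for i
    using Ints_less_imp_add1_le [OF c(2) _ that] xi bi by (auto simp: integral_vec_def)
  show "(\<Sum>i\<in>UNIV. 1 $ i * max 0 (\<bar>(x $ i + b $ i) / 1 $ i\<bar> - c))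
    \<le> (\<Sum>i\<in>UNIV. 1 $ i * max 0 (\<bar>(y $ i + b $ i) / 1 $ i\<bar> - c))"
    by (rule locally_optimal_hinge_le [OF h _ yB g opt _ c(1) gap]) auto
qed

theorem lemma13:
  fixes h :: "'n::finite set \<times> 'n set \<Rightarrow> real"
    and a b :: "real ^ 'n"
  assumes "bisubmodular h"
    and "\<forall>i. a $ i > 0"
  shows "(\<forall>x. is_arg_min (\<lambda>x. \<Sum>i\<in>UNIV. 1 / 2 * ((x $ i + b $ i)\<^sup>2 / a $ i))
                (\<lambda>x. x \<in> bisub_polyhedron h) x
            \<longrightarrow> least_weakly_abs_majorized a b (bisub_polyhedron h) x) \<and>
         (integral_setfun h \<and> integral_vec b \<longrightarrow>
           (\<forall>x. is_arg_min (\<lambda>x. \<Sum>i\<in>UNIV. 1 / 2 * (x $ i + b $ i)\<^sup>2)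
                (\<lambda>x. x \<in> bisub_polyhedron_int h) x
            \<longrightarrow> least_weakly_abs_majorized 1 b (bisub_polyhedron_int h) x))"
proof -
  have cost: "(\<lambda>x. \<Sum>i\<in>UNIV. 1 / 2 * ((x $ i + b $ i)\<^sup>2 / a $ i)) = quad_cost a b"
    "(\<lambda>x. \<Sum>i\<in>UNIV. 1 / 2 * (x $ i + b $ i)\<^sup>2) = quad_cost 1 b"
    by (simp_all add: quad_cost_def fun_eq_iff)
  show ?thesis
    unfolding cost is_arg_min_def least_weakly_abs_majorized_def
    using real_arg_min_majorized [OF assms, of _ b]
      integral_arg_min_majorized [OF assms(1), of b]
    by (auto simp: not_less)
qed

end
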